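(* Let $1\le k\le n$ and let $\mathcal{M}$ be the rank-$k$ uniform matroid on a ground set of size $n$ (bases: all $k$-element subsets). The Ollivier--Ricci curvature $\kappa$ of the basis exchange walk on $\mathcal{M}$ satisfies \[\kappa \geq 1 - \frac{(k-1)(n-k)}{k(n-k+1)}.\]
   Context: For a matroid $\mathcal{M}=(E,\mathcal{B})$ with set of bases $\mathcal{B}$ all of size $k$, write $B-u$ for $B\setminus\{u\}$. The basis exchange walk (down-up walk) on $\mathcal{M}$ is the Markov chain $P$ on $\mathcal{B}$ that from $S\in\mathcal{B}$ drops an element $u\in S$ chosen uniformly at random, then moves to a uniformly random basis containing $S-u$ (possibly $S$ itself). The metric on $\mathcal{B}$ is $d(S,T)=\inf\{t\ge 0: P^t(S,T)>0\}$. The Wasserstein distance is $\mathcal{W}(\mu,\nu)=\min \mathbb{E}\, d(X,Y)$, the minimum being over all couplings $(X,Y)$ of $X\sim\mu$ and $Y\sim\nu$. The Ollivier--Ricci curvature $\kappa$ of $P$ is the largest $\kappa$ such that $\mathcal{W}(P(S,\cdot),P(T,\cdot))\le(1-\kappa)\,d(S,T)$ for all $S,T\in\mathcal{B}$, i.e. $\kappa=\inf_{S\ne T}\left(1-\mathcal{W}(P(S,\cdot),P(T,\cdot))/d(S,T)\right)$ (with $\kappa=+\infty$ if there is only one basis). *)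

theory Defs
  imports "HOL-Probability.Probability"
begin

section \<open>Markov chains, Wasserstein distance and Ollivier--Ricci curvature\<close>

primrec markov_power :: "('s \<Rightarrow> 's pmf) \<Rightarrow> nat \<Rightarrow> 's \<Rightarrow> 's pmf" where
  "markov_power P 0 x = return_pmf x"
| "markov_power P (Suc t) x = bind_pmf (P x) (markov_power P t)"

text \<open>The values are extended naturals so that the infimum of the empty set is \<open>\<infinity>\<close>
  (on \<open>nat\<close> it would be \<open>0\<close>).\<close>

definition markov_dist :: "('s \<Rightarrow> 's pmf) \<Rightarrow> 's \<Rightarrow> 's \<Rightarrow> enat" where
  "markov_dist P x y = (INF t \<in> {t. pmf (markov_power P t x) y > 0}. enat t)"

definition couplings :: "'s pmf \<Rightarrow> 's pmf \<Rightarrow> ('s \<times> 's) pmf set" where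
  "couplings \<mu> \<nu> = {q. map_pmf fst q = \<mu> \<and> map_pmf snd q = \<nu>}"

definition wasserstein :: "('s \<Rightarrow> 's \<Rightarrow> enat) \<Rightarrow> 's pmf \<Rightarrow> 's pmf \<Rightarrow> ennreal" where
  "wasserstein d \<mu> \<nu> =
     (INF q \<in> couplings \<mu> \<nu>. \<integral>\<^sup>+ z. ennreal_of_enat (d (fst z) (snd z)) \<partial>measure_pmf q)"

text \<open>The curvature of the chain \<open>P\<close> on the state space \<open>V\<close>, with respect to the metric
  induced by \<open>P\<close> itself. It is \<open>\<infinity>\<close> (the infimum of the empty set) if \<open>V\<close> has
  at most one element.\<close>

definition ollivier_ricci_curvature :: "'s set \<Rightarrow> ('s \<Rightarrow> 's pmf) \<Rightarrow> ereal" where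
  "ollivier_ricci_curvature V P =
     (INF (x, y) \<in> {(x, y). x \<in> V \<and> y \<in> V \<and> x \<noteq> y}.
        1 - enn2ereal (wasserstein (markov_dist P) (P x) (P y)) / ereal_of_enat (markov_dist P x y))"


section \<open>Matroids and the basis exchange walk\<close>

locale matroid =
  fixes E :: "'a set" and \<B> :: "'a set set"
  assumes finite_ground: "finite E"
    and bases_subset: "B \<in> \<B> \<Longrightarrow> B \<subseteq> E"
    and bases_nonempty: "\<B> \<noteq> {}"
    and basis_exchange: "\<lbrakk>A \<in> \<B>; B \<in> \<B>; a \<in> A - B\<rbrakk>
                          \<Longrightarrow> \<exists>b \<in> B - A. insert b (A - {a}) \<in> \<B>"

text \<open>The walk depends on the matroid only through its set of bases \<open>\<B>\<close>. The definition is
  meaningful for matroids of positive rank: there both sets sampled from are finite and nonempty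
  whenever \<open>S \<in> \<B>\<close>.\<close>

definition basis_exchange_walk :: "'a set set \<Rightarrow> 'a set \<Rightarrow> 'a set pmf" where
  "basis_exchange_walk \<B> S =
     bind_pmf (pmf_of_set S) (\<lambda>u. pmf_of_set {T \<in> \<B>. S - {u} \<subseteq> T})"

definition uniform_matroid_bases :: "'a set \<Rightarrow> nat \<Rightarrow> 'a set set" where
  "uniform_matroid_bases E k = {B. B \<subseteq> E \<and> card B = k}"

lemma matroid_uniform:
  assumes "finite E" and "k \<le> card E"
  shows "matroid E (uniform_matroid_bases E k)"
proof
  show "finite E" by fact
  show "B \<subseteq> E" if "B \<in> uniform_matroid_bases E k" for B
    using that by (simp add: uniform_matroid_bases_def)
  show "uniform_matroid_bases E k \<noteq> {}"
    using obtain_subset_with_card_n[OF assms(2)] by (auto simp: uniform_matroid_bases_def)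
  fix A B a
  assume A: "A \<in> uniform_matroid_bases E k" and B: "B \<in> uniform_matroid_bases E k"
    and a: "a \<in> A - B"
  have fin: "finite A" "finite B"
    using A B assms(1) by (auto simp: uniform_matroid_bases_def intro: finite_subset)
  have "\<not> B \<subseteq> A"
    using A B a fin card_subset_eq[of A B] by (auto simp: uniform_matroid_bases_def)
  then obtain b where b: "b \<in> B - A" by blast
  have "card (insert b (A - {a})) = card A"
    using a b fin card_Suc_Diff1[of A a] by simp
  then have "insert b (A - {a}) \<in> uniform_matroid_bases E k"
    using A B b by (auto simp: uniform_matroid_bases_def)
  with b show "\<exists>b \<in> B - A. insert b (A - {a}) \<in> uniform_matroid_bases E k" by blast
qed

end

theory Submission
  imports Defs
begin

text \<open>The distance between two bases is \<open>card (S - T)\<close>. To couple the steps from \<open>S\<close> and \<open>T\<close>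
  at any distance \<open>m\<close>, drop matched elements under a bijection \<open>S \<rightarrow> T\<close> fixing \<open>S \<inter> T\<close>, then add
  matched elements under a bijection between the complements fixing their common part. A drop
  lowers the distance by one exactly when the element lies outside \<open>S \<inter> T\<close>, which multiplies the
  expected distance by \<open>1 - 1/k\<close>; likewise the addition multiplies it by \<open>1 - 1/(n-k+1)\<close>.
  No path coupling is needed, since this works for all pairs at once.\<close>

section \<open>Matchings of finite sets and uniform averages\<close>

text \<open>Equal cardinalities of \<open>A\<close> and \<open>B\<close> force equal cardinalities
  of \<open>A - B\<close> and \<open>B - A\<close>, so the identity on the intersection extends by
  any bijection between these two.\<close>

lemma ex_bij_betw_fixing_Int:
  assumes "finite A" "finite B" "card A = card B"
  shows "\<exists>f. bij_betw f A B \<and> (\<forall>x\<in>A \<inter> B. f x = x)"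
proof -
  have "card (A - B) = card (B - A)"
    using assms by (metis card_Diff_subset_Int finite_Int inf_commute)
  then obtain g where g: "bij_betw g (A - B) (B - A)"
    using assms by (meson finite_Diff finite_same_card_bij)
  define f where "f = (\<lambda>x. if x \<in> B then x else g x)"
  have "bij_betw f (A \<inter> B) (A \<inter> B)"
    by (rule bij_betwI[where g = "\<lambda>x. x"]) (auto simp: f_def)
  moreover have "bij_betw f (A - B) (B - A)"
    using g by (subst bij_betw_cong[where g = g]) (auto simp: f_def)
  ultimately have "bij_betw f (A \<inter> B \<union> (A - B)) (A \<inter> B \<union> (B - A))"
    by (rule bij_betw_combine) auto
  moreover have "A \<inter> B \<union> (A - B) = A" "A \<inter> B \<union> (B - A) = B" by auto
  ultimately show ?thesis by (intro exI[of _ f]) (auto simp: f_def)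
qed

text \<open>Moves expected distances into the reals, where the decrements produced by the matchings
  can be subtracted without truncation.\<close>

lemma nn_integral_pmf_of_set_ennreal:
  assumes "finite A" "A \<noteq> {}" "\<And>x. x \<in> A \<Longrightarrow> g x = ennreal (f x)" "\<And>x. x \<in> A \<Longrightarrow> 0 \<le> f x"
  shows "(\<integral>\<^sup>+ x. g x \<partial>measure_pmf (pmf_of_set A)) = ennreal ((\<Sum>x\<in>A. f x) / real (card A))"
proof -
  have "(\<integral>\<^sup>+ x. g x \<partial>measure_pmf (pmf_of_set A)) = (\<Sum>x\<in>A. g x) / of_nat (card A)"
    using assms(1,2) by (simp add: nn_integral_pmf_of_set)
  also have "(\<Sum>x\<in>A. g x) = ennreal (\<Sum>x\<in>A. f x)"
    using assms(3,4) by (simp add: sum_ennreal)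
  also have "\<dots> / of_nat (card A) = ennreal ((\<Sum>x\<in>A. f x) / real (card A))"
    using assms by (subst ennreal_of_nat_eq_real_of_nat, subst divide_ennreal)
      (auto simp: sum_nonneg card_gt_0_iff)
  finally show ?thesis .
qed

lemma drop_matching:
  assumes "finite S" "finite T" "card S = card T"
  obtains f where "bij_betw f S T"
    "\<And>u. u \<in> S \<Longrightarrow> real (card ((S - {u}) - (T - {f u}))) = real (card (S - T)) - of_bool (u \<notin> T)"
proof -
  obtain f where f: "bij_betw f S T" "\<forall>x\<in>S \<inter> T. f x = x"
    using ex_bij_betw_fixing_Int[OF assms] by blast
  have "real (card ((S - {u}) - (T - {f u}))) = real (card (S - T)) - of_bool (u \<notin> T)"
    if u: "u \<in> S" for u
  proof (cases "u \<in> T")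
    case True
    then have "(S - {u}) - (T - {f u}) = S - T" using f u by auto
    then show ?thesis using True by simp
  next
    case False
    \<comment> \<open>An element of \<open>S \<inter> T\<close> already has itself as preimage, so
      injectivity keeps \<open>f u\<close> out of \<open>S\<close>. Removing \<open>f u\<close> from
      \<open>T\<close> then adds nothing to the difference.\<close>
    have "f u \<notin> S"
    proof
      assume "f u \<in> S"
      moreover have "f u \<in> T" using f(1) u by (auto dest: bij_betwE)
      ultimately have "f (f u) = f u" using f(2) by blast
      then have "f u = u"
        using f(1) u \<open>f u \<in> S\<close> by (meson bij_betw_imp_inj_on inj_onD)
      then show False using \<open>f u \<in> T\<close> False by simp
    qed
    then have "(S - {u}) - (T - {f u}) = (S - T) - {u}" by auto
    moreover have "Suc (card (S - T - {u})) = card (S - T)"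
      using assms(1) u False by (intro card_Suc_Diff1) auto
    ultimately show ?thesis using False by simp
  qed
  then show thesis using f(1) by (intro that)
qed

lemma add_matching:
  assumes "finite E" "S \<subseteq> E" "T \<subseteq> E" "card S = card T"
  obtains f where "bij_betw f (E - S) (E - T)"
    "\<And>x. x \<in> E - S \<Longrightarrow>
       real (card (insert x S - insert (f x) T)) = real (card (S - T)) - of_bool (x \<in> T)"
proof -
  have fin: "finite S" "finite T" using assms finite_subset by auto
  have "card (E - S) = card (E - T)"
    using assms fin by (simp add: card_Diff_subset)
  \<comment> \<open>Adding \<open>x\<close> to \<open>S\<close> is dropping \<open>x\<close> from \<open>E - S\<close>.\<close>
  then obtain f where f: "bij_betw f (E - S) (E - T)"
    "\<And>u. u \<in> E - S \<Longrightarrow> real (card (((E - S) - {u}) - ((E - T) - {f u})))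
       = real (card ((E - S) - (E - T))) - of_bool (u \<notin> E - T)"
    using drop_matching[of "E - S" "E - T"] assms(1) by blast
  have "real (card (insert x S - insert (f x) T)) = real (card (S - T)) - of_bool (x \<in> T)"
    if x: "x \<in> E - S" for x
  proof -
    have fx: "f x \<in> E - T" using f(1) x by (auto dest: bij_betwE)
    have "card (insert x S) = card (insert (f x) T)"
      using x fx fin assms(4) by simp
    \<comment> \<open>Complementation reverses set differences. Both orientations have the same size
      because the two enlarged sets do; the same flip is applied to \<open>S\<close> and
      \<open>T\<close> below.\<close>
    then have "card (insert x S - insert (f x) T) = card (insert (f x) T - insert x S)"
      using fin by (metis card_Diff_subset_Int finite_Int finite_insert inf_commute)
    also have "insert (f x) T - insert x S = ((E - S) - {x}) - ((E - T) - {f x})"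
      using assms x fx by auto
    finally have "real (card (insert x S - insert (f x) T))
        = real (card ((E - S) - (E - T))) - of_bool (x \<notin> E - T)"
      using f(2)[OF x] by simp
    moreover have "card ((E - S) - (E - T)) = card (S - T)"
    proof -
      have "(E - S) - (E - T) = T - S" using assms by auto
      then show ?thesis using fin assms(4) by (metis card_Diff_subset_Int finite_Int inf_commute)
    qed
    ultimately show ?thesis using x by simp
  qed
  then show thesis using f(1) by (intro that)
qed

text \<open>A basis above \<open>R\<close> exceeds it by exactly one element, so drawing the basis
  amounts to drawing that element, which is what \<open>add_matching\<close> can couple.\<close>

lemma up_step_uniform:
  assumes "finite E" "R \<subseteq> E" "Suc (card R) = k" "k \<le> card E"
  shows "pmf_of_set {T \<in> uniform_matroid_bases E k. R \<subseteq> T}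
           = map_pmf (\<lambda>x. insert x R) (pmf_of_set (E - R))"
proof -
  have fin: "finite R" using assms finite_subset by auto
  have "{T \<in> uniform_matroid_bases E k. R \<subseteq> T} = (\<lambda>x. insert x R) ` (E - R)" (is "?L = ?R")
  proof
    show "?R \<subseteq> ?L" using assms fin by (auto simp: uniform_matroid_bases_def)
    show "?L \<subseteq> ?R"
    proof
      fix T assume T: "T \<in> ?L"
      then have "finite T" using assms(1) finite_subset by (auto simp: uniform_matroid_bases_def)
      with T fin assms(3) have "card (T - R) = 1"
        by (auto simp: uniform_matroid_bases_def card_Diff_subset)
      then obtain x where "T - R = {x}" by (auto simp: card_1_singleton_iff)
      with T show "T \<in> ?R" by (auto simp: uniform_matroid_bases_def intro!: image_eqI[of _ _ x])
    qed
  qed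
  moreover have "E - R \<noteq> {}"
    using assms fin by (metis Diff_eq_empty_iff card_mono not_less_eq_eq order_trans)
  moreover have "inj_on (\<lambda>x. insert x R) (E - R)" by (auto simp: inj_on_def)
  ultimately show ?thesis using assms(1) by (simp add: map_pmf_of_set_inj)
qed

section \<open>The walk on the uniform matroid\<close>

context
  fixes E :: "'a set" and k :: nat
  assumes finite_E: "finite E" and k_pos: "1 \<le> k" and k_le: "k \<le> card E"
begin

private abbreviation (input) "bases \<equiv> uniform_matroid_bases E k"
private abbreviation (input) "walk \<equiv> basis_exchange_walk bases"

private lemma basesD:
  assumes "S \<in> bases"
  shows "finite S" "S \<subseteq> E" "card S = k" "S \<noteq> {}"
  using assms finite_E k_pos finite_subset by (auto simp: uniform_matroid_bases_def)

private lemma card_drop: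
  assumes "S \<in> bases" "u \<in> S"
  shows "Suc (card (S - {u})) = k"
  using basesD[OF assms(1)] assms(2) by (metis card_Suc_Diff1)

text \<open>The drop-then-add form that both marginals of the coupling are compared with.\<close>

private lemma walk_eq:
  assumes "S \<in> bases"
  shows "walk S = bind_pmf (pmf_of_set S)
           (\<lambda>u. map_pmf (\<lambda>x. insert x (S - {u})) (pmf_of_set (E - (S - {u}))))"
  unfolding basis_exchange_walk_def
proof (rule bind_pmf_cong[OF refl])
  fix u assume "u \<in> set_pmf (pmf_of_set S)"
  then have "u \<in> S" using basesD[OF assms] by simp
  then show "pmf_of_set {T \<in> bases. S - {u} \<subseteq> T}
      = map_pmf (\<lambda>x. insert x (S - {u})) (pmf_of_set (E - (S - {u})))"
    using up_step_uniform[OF finite_E _ card_drop[OF assms] k_le, of u] basesD[OF assms] by blast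
qed

private lemma set_walk:
  assumes "S \<in> bases"
  shows "set_pmf (walk S) = {insert x (S - {u}) | x u. u \<in> S \<and> x \<in> E - (S - {u})}"
proof -
  have "E - (S - {u}) \<noteq> {}" if "u \<in> S" for u
    using basesD(2)[OF assms] that by blast
  then show ?thesis
    using basesD[OF assms] finite_E unfolding walk_eq[OF assms] by (auto simp: set_bind_pmf)
qed

private lemma walk_bases:
  assumes "S \<in> bases" "T \<in> set_pmf (walk S)"
  shows "T \<in> bases" "card (S - T) \<le> 1"
proof -
  obtain x u where T: "T = insert x (S - {u})" "u \<in> S" "x \<in> E - (S - {u})"
    using assms by (auto simp: set_walk)
  show "T \<in> bases"
    using T basesD[OF assms(1)] card_drop[OF assms(1) T(2)]
    by (auto simp: uniform_matroid_bases_def)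
  have "S - T \<subseteq> {u}" using T by auto
  then show "card (S - T) \<le> 1" using card_mono[of "{u}"] by simp
qed

section \<open>The walk distance as the size of a set difference\<close>

text \<open>Lower bound on the distance: a step removes at most one element, and
  \<open>S - T\<close> is covered by \<open>S - R\<close> and \<open>R - T\<close> for every
  intermediate \<open>R\<close>.\<close>

private lemma card_Diff_le_markov_power:
  assumes "S \<in> bases" "T \<in> set_pmf (markov_power walk t S)"
  shows "card (S - T) \<le> t"
  using assms
proof (induction t arbitrary: S)
  case 0
  then show ?case by simp
next
  case (Suc t)
  then obtain R where R: "R \<in> set_pmf (walk S)" "T \<in> set_pmf (markov_power walk t R)"
    by (auto simp: set_bind_pmf)
  note RB = walk_bases[OF Suc.prems(1) R(1)]
  have "S - T \<subseteq> (S - R) \<union> (R - T)" by auto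
  moreover have "finite ((S - R) \<union> (R - T))"
    using basesD Suc.prems(1) RB by blast
  ultimately have "card (S - T) \<le> card (S - R) + card (R - T)"
    by (meson card_Un_le card_mono le_trans)
  also have "\<dots> \<le> 1 + t" using Suc.IH[OF RB(1) R(2)] RB(2) by simp
  finally show ?case by simp
qed

text \<open>Upper bound on the distance: exchanging some \<open>u\<close> in \<open>S - T\<close>
  for some \<open>x\<close> in \<open>T - S\<close> is a possible step, since every
  \<open>k\<close>-subset of \<open>E\<close> is a basis, and it shrinks the difference by
  one.\<close>

private lemma markov_power_reaches:
  assumes "S \<in> bases" "T \<in> bases" "card (S - T) = t"
  shows "T \<in> set_pmf (markov_power walk t S)"
  using assms
proof (induction t arbitrary: S)
  case 0
  then have "S \<subseteq> T" using basesD(1)[of S] by simp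
  then have "S = T" using basesD[OF 0(1)] basesD[OF 0(2)] card_subset_eq by metis
  then show ?case by simp
next
  case (Suc t)
  note S = basesD[OF Suc.prems(1)] and T = basesD[OF Suc.prems(2)]
  obtain u where u: "u \<in> S - T" using Suc.prems(3) by (metis card.empty ex_in_conv nat.distinct(1))
  have "\<not> T \<subseteq> S" using u S T card_subset_eq by (metis DiffD2 DiffD1)
  then obtain x where x: "x \<in> T - S" by blast
  define R where "R = insert x (S - {u})"
  have R: "R \<in> set_pmf (walk S)"
    unfolding set_walk[OF Suc.prems(1)] R_def using u x T by blast
  have "R - T = (S - T) - {u}" using x u by (auto simp: R_def)
  then have "card (R - T) = t" using u S Suc.prems(3) by simp
  then have "T \<in> set_pmf (markov_power walk t R)"
    using Suc.IH walk_bases(1)[OF Suc.prems(1) R] Suc.prems(2) by blast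
  then show ?case using R by (auto simp: set_bind_pmf)
qed

lemma markov_dist_uniform_matroid:
  assumes "S \<in> bases" "T \<in> bases"
  shows "markov_dist walk S T = enat (card (S - T))"
  unfolding markov_dist_def
proof (rule antisym)
  show "(INF t \<in> {t. 0 < pmf (markov_power walk t S) T}. enat t) \<le> enat (card (S - T))"
    using markov_power_reaches[OF assms refl] by (intro INF_lower) (simp add: pmf_positive_iff)
  show "enat (card (S - T)) \<le> (INF t \<in> {t. 0 < pmf (markov_power walk t S) T}. enat t)"
    using card_Diff_le_markov_power[OF assms(1)] by (intro INF_greatest) (simp add: pmf_positive_iff)
qed

section \<open>Contraction under the matching coupling\<close>

text \<open>Any coupling bounds the infimum from above. The one used drops \<open>u\<close> with
  \<open>f u\<close>, then adds \<open>x\<close> with \<open>g u x\<close>; each stage contributes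
  one factor.\<close>

lemma wasserstein_uniform_matroid_le:
  assumes ST: "S \<in> bases" "T \<in> bases"
  shows "wasserstein (markov_dist walk) (walk S) (walk T)
           \<le> ennreal ((1 - 1 / real k) * (1 - 1 / (real (card E) - real k + 1)) * real (card (S - T)))"
proof -
  note S = basesD[OF ST(1)] and T = basesD[OF ST(2)]
  \<comment> \<open>\<open>N\<close> is the number of elements outside a set of size
    \<open>k - 1\<close>, that is, of candidates for the addition.\<close>
  define N where "N = real (card E) - real k + 1"
  define m where "m = real (card (S - T))"
  have N: "N \<ge> 1" using k_le by (simp add: N_def)
  obtain f where f: "bij_betw f S T"
    "\<And>u. u \<in> S \<Longrightarrow> real (card ((S - {u}) - (T - {f u}))) = m - of_bool (u \<notin> T)"
    using drop_matching[of S T] S T unfolding m_def by metis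
  have fT: "f u \<in> T" if "u \<in> S" for u using f(1) that by (auto dest: bij_betwE)
  \<comment> \<open>The matching for the addition depends on the dropped pair, so one is chosen for
    each \<open>u\<close>.\<close>
  have "\<exists>g. \<forall>u\<in>S. bij_betw (g u) (E - (S - {u})) (E - (T - {f u})) \<and>
     (\<forall>x\<in>E - (S - {u}). real (card (insert x (S - {u}) - insert (g u x) (T - {f u})))
         = real (card ((S - {u}) - (T - {f u}))) - of_bool (x \<in> T - {f u}))"
  proof (rule bchoice, rule ballI)
    fix u assume u: "u \<in> S"
    have "card (S - {u}) = card (T - {f u})"
      using card_drop[OF ST(1) u] card_drop[OF ST(2) fT[OF u]] by simp
    then obtain g where "bij_betw g (E - (S - {u})) (E - (T - {f u}))"
      "\<And>x. x \<in> E - (S - {u}) \<Longrightarrow> real (card (insert x (S - {u}) - insert (g x) (T - {f u})))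
         = real (card ((S - {u}) - (T - {f u}))) - of_bool (x \<in> T - {f u})"
      using add_matching[of E "S - {u}" "T - {f u}"] finite_E S T by blast
    then show "\<exists>g. bij_betw g (E - (S - {u})) (E - (T - {f u})) \<and>
     (\<forall>x\<in>E - (S - {u}). real (card (insert x (S - {u}) - insert (g x) (T - {f u})))
         = real (card ((S - {u}) - (T - {f u}))) - of_bool (x \<in> T - {f u}))"
      by blast
  qed
  then obtain g where g: "\<And>u. u \<in> S \<Longrightarrow> bij_betw (g u) (E - (S - {u})) (E - (T - {f u}))"
    "\<And>u x. u \<in> S \<Longrightarrow> x \<in> E - (S - {u}) \<Longrightarrow>
       real (card (insert x (S - {u}) - insert (g u x) (T - {f u})))
         = real (card ((S - {u}) - (T - {f u}))) - of_bool (x \<in> T - {f u})"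
    by blast
  define q where "q = bind_pmf (pmf_of_set S) (\<lambda>u.
     map_pmf (\<lambda>x. (insert x (S - {u}), insert (g u x) (T - {f u}))) (pmf_of_set (E - (S - {u}))))"
  have ne: "E - (S - {u}) \<noteq> {}" if "u \<in> S" for u
    using S that by blast
  have q1: "map_pmf fst q = walk S"
    by (simp add: q_def walk_eq[OF ST(1)] map_bind_pmf pmf.map_comp o_def)
  \<comment> \<open>Second marginal: the bijections \<open>g u\<close> and \<open>f\<close> carry
    uniform draws to uniform draws, so the shared randomness of \<open>u\<close> and
    \<open>x\<close> yields a genuine step from \<open>T\<close>.\<close>
  have "map_pmf snd q = bind_pmf (pmf_of_set S) (\<lambda>u.
      map_pmf (\<lambda>x. insert x (T - {f u})) (map_pmf (g u) (pmf_of_set (E - (S - {u})))))"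
    by (simp add: q_def map_bind_pmf pmf.map_comp o_def)
  also have "\<dots> = bind_pmf (pmf_of_set S) (\<lambda>u.
      map_pmf (\<lambda>x. insert x (T - {f u})) (pmf_of_set (E - (T - {f u}))))"
    using S finite_E ne by (intro bind_pmf_cong refl) (simp add: map_pmf_of_set_bij_betw[OF g(1)])
  also have "\<dots> = bind_pmf (map_pmf f (pmf_of_set S)) (\<lambda>v.
      map_pmf (\<lambda>x. insert x (T - {v})) (pmf_of_set (E - (T - {v}))))"
    by (simp add: bind_map_pmf)
  also have "\<dots> = walk T"
    using S by (simp add: map_pmf_of_set_bij_betw[OF f(1)] walk_eq[OF ST(2)])
  finally have q: "q \<in> couplings (walk S) (walk T)"
    using q1 by (simp add: couplings_def)
  have up: "(\<integral>\<^sup>+ x. ennreal_of_enat (markov_dist walk (insert x (S - {u})) (insert (g u x) (T - {f u})))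
        \<partial>measure_pmf (pmf_of_set (E - (S - {u})))) = ennreal ((1 - 1 / N) * (m - of_bool (u \<notin> T)))"
    if u: "u \<in> S" for u
  proof -
    define S' T' where "S' = S - {u}" and "T' = T - {f u}"
    have S': "Suc (card S') = k" "S' \<subseteq> E" "finite S'"
      using card_drop[OF ST(1) u] S by (auto simp: S'_def)
    have T': "Suc (card T') = k" "T' \<subseteq> E" "finite T'"
      using card_drop[OF ST(2) fT[OF u]] T by (auto simp: T'_def)
    have cN: "real (card (E - S')) = N"
      using S' finite_E k_le by (simp add: card_Diff_subset N_def of_nat_diff)
    define j where "j = real (card (S' - T'))"
    \<comment> \<open>The addition gains exactly when \<open>x\<close> lies in
      \<open>T' - S'\<close>. As this set also has \<open>j\<close> elements, \<open>j\<close> of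
      the \<open>N\<close> candidates lower the distance.\<close>
    have j: "j = real (card (T' - S'))"
      using S' T' unfolding j_def by (metis card_Diff_subset_Int finite_Int inf_commute nat.inject)
    have gx: "real (card (insert x S' - insert (g u x) T')) = j - of_bool (x \<in> T')"
      if "x \<in> E - S'" for x
      using g(2)[OF u] that by (simp add: S'_def T'_def j_def)
    \<comment> \<open>Nonnegativity comes for free: the real expression equals a
      cardinality.\<close>
    have "ennreal_of_enat (markov_dist walk (insert x S') (insert (g u x) T'))
        = ennreal (j - of_bool (x \<in> T')) \<and> 0 \<le> j - of_bool (x \<in> T')"
      if x: "x \<in> E - S'" for x
    proof -
      have "g u x \<in> E - T'" using bij_betwE[OF g(1)[OF u]] x by (simp add: S'_def T'_def)
      then have "insert x S' \<in> bases" "insert (g u x) T' \<in> bases"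
        using S' T' x by (auto simp: uniform_matroid_bases_def)
      then show ?thesis
        using gx[OF x] by (metis markov_dist_uniform_matroid ennreal_of_enat_enat
          ennreal_of_nat_eq_real_of_nat of_nat_0_le_iff)
    qed
    then have "(\<integral>\<^sup>+ x. ennreal_of_enat (markov_dist walk (insert x S') (insert (g u x) T'))
        \<partial>measure_pmf (pmf_of_set (E - S')))
        = ennreal ((\<Sum>x\<in>E - S'. j - of_bool (x \<in> T')) / N)"
      using finite_E ne[OF u] cN
      by (subst nn_integral_pmf_of_set_ennreal[where f = "\<lambda>x. j - of_bool (x \<in> T')"])
        (auto simp: S'_def)
    also have "(\<Sum>x\<in>E - S'. j - of_bool (x \<in> T')) = N * j - real (card ((E - S') \<inter> T'))"
      using finite_E cN by (simp add: sum_subtractf sum_of_bool_eq Int_def)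
    also have "(E - S') \<inter> T' = T' - S'" using T' by auto
    also have "(N * j - real (card (T' - S'))) / N = (1 - 1 / N) * j"
      using N j by (simp add: field_simps)
    also have "j = m - of_bool (u \<notin> T)"
      using f(2)[OF u] by (simp add: j_def S'_def T'_def)
    finally show ?thesis by (simp add: S'_def T'_def)
  qed
  have "wasserstein (markov_dist walk) (walk S) (walk T)
      \<le> (\<integral>\<^sup>+ z. ennreal_of_enat (markov_dist walk (fst z) (snd z)) \<partial>measure_pmf q)"
    unfolding wasserstein_def using q by (rule INF_lower)
  also have "\<dots> = (\<integral>\<^sup>+ u. (\<integral>\<^sup>+ x. ennreal_of_enat
        (markov_dist walk (insert x (S - {u})) (insert (g u x) (T - {f u})))
        \<partial>measure_pmf (pmf_of_set (E - (S - {u})))) \<partial>measure_pmf (pmf_of_set S))"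
    by (simp add: q_def)
  also have "\<dots> = ennreal ((\<Sum>u\<in>S. (1 - 1 / N) * (m - of_bool (u \<notin> T))) / real (card S))"
  proof (rule nn_integral_pmf_of_set_ennreal[OF S(1) S(4) up])
    fix u assume "u \<in> S"
    then have "0 \<le> m - of_bool (u \<notin> T)" using f(2) by (metis of_nat_0_le_iff)
    then show "0 \<le> (1 - 1 / N) * (m - of_bool (u \<notin> T))" using N by simp
  qed
  \<comment> \<open>Drop stage: of the \<open>k\<close> elements of \<open>S\<close>, exactly the
    \<open>m\<close> in \<open>S - T\<close> lower the difference.\<close>
  also have "(\<Sum>u\<in>S. (1 - 1 / N) * (m - of_bool (u \<notin> T))) = (1 - 1 / N) * (real k * m - m)"
  proof -
    have "(\<Sum>u\<in>S. m - of_bool (u \<notin> T)) = real k * m - real (card (S \<inter> {u. u \<notin> T}))"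
      using S by (simp add: sum_subtractf sum_of_bool_eq)
    also have "S \<inter> {u. u \<notin> T} = S - T" by auto
    finally show ?thesis by (simp add: sum_distrib_left[symmetric] m_def)
  qed
  also have "(1 - 1 / N) * (real k * m - m) / real (card S) = (1 - 1 / real k) * (1 - 1 / N) * m"
    using S k_pos N by (simp add: field_simps)
  finally show ?thesis by (simp add: N_def m_def)
qed

end

section \<open>From contraction to curvature\<close>

theorem lemma4p4:
  fixes E :: "'a set" and k n :: nat
  assumes "finite E" and "card E = n" and "1 \<le> k" and "k \<le> n"
  shows "ollivier_ricci_curvature (uniform_matroid_bases E k)
           (basis_exchange_walk (uniform_matroid_bases E k))
         \<ge> ereal (1 - ((real k - 1) * (real n - real k)) / (real k * (real n - real k + 1)))"
  unfolding ollivier_ricci_curvature_def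
\<comment> \<open>With a single basis the infimum is over the empty set, so the pairwise bound holds
  vacuously.\<close>
proof (rule INF_greatest, clarify)
  let ?B = "uniform_matroid_bases E k"
  let ?P = "basis_exchange_walk ?B"
  let ?r = "((real k - 1) * (real n - real k)) / (real k * (real n - real k + 1))"
  have k: "k \<le> card E" using assms by simp
  fix S T assume ST: "S \<in> ?B" "T \<in> ?B" "S \<noteq> T"
  define m where "m = card (S - T)"
  have fin: "finite S" "finite T" "card S = card T"
    using ST assms(1) finite_subset by (auto simp: uniform_matroid_bases_def)
  then have "\<not> S \<subseteq> T" using ST(3) card_subset_eq by blast
  then have m: "m > 0" using fin by (auto simp: m_def card_gt_0_iff)
  \<comment> \<open>The factors are \<open>(k - 1) / k\<close> and
    \<open>(n - k) / (n - k + 1)\<close>.\<close>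
  have "(1 - 1 / real k) * (1 - 1 / (real n - real k + 1)) = ?r"
    using assms(3,4) by (simp add: field_simps)
  then have "wasserstein (markov_dist ?P) (?P S) (?P T) \<le> ennreal (?r * real m)"
    using wasserstein_uniform_matroid_le[OF assms(1,3) k ST(1,2)] assms(2) by (simp add: m_def)
  moreover have "0 \<le> ?r * real m" using assms(3,4) by simp
  \<comment> \<open>The bound makes the Wasserstein distance a finite real \<open>w\<close>; as
    \<open>m\<close> is positive, the quotient in \<open>ereal\<close> becomes an ordinary real
    quotient.\<close>
  ultimately obtain w where w: "wasserstein (markov_dist ?P) (?P S) (?P T) = ennreal w"
    "0 \<le> w" "w \<le> ?r * real m"
    by (cases "wasserstein (markov_dist ?P) (?P S) (?P T)") (auto simp: top_unique)
  have "w / real m \<le> ?r" using w(3) m by (simp add: pos_divide_le_eq)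
  then show "ereal (1 - ?r) \<le> 1 - enn2ereal (wasserstein (markov_dist ?P) (?P S) (?P T))
      / ereal_of_enat (markov_dist ?P S T)"
    using w m markov_dist_uniform_matroid[OF assms(1,3) k ST(1,2)]
    by (simp add: m_def one_ereal_def)
qed

end
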